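(* Let $\mathcal E$ be a finite-dimensional real inner product space, let $F\colon\mathcal E\to\mathcal E$ be locally Lipschitz continuous and monotone, let $g\colon\mathcal E\to(-\infty,+\infty]$ be a proper lower semicontinuous convex function whose restriction $g|_{\operatorname{dom} g}$ is continuous, and suppose that the set of $x^*\in\mathcal E$ with $\langle F(x^* ),x-x^*\rangle+g(x)-g(x^* )\ge 0$ for all $x\in\mathcal E$ is nonempty. Let $(x_n)$ and $(y_n)$, with corresponding $(\lambda_n)$, $(\tau_n)$, be the sequences generated either by Algorithm 1 (in the case $g=\delta_C$ with $C\subseteq\mathcal E$ closed and convex) or by Algorithm 2, both described in the context. Define $$\overline\lambda_N=\sum_{n=1}^N\lambda_n+\tau_1\lambda_1,\qquad \overline x_N=\frac1{\overline\lambda_N}\Bigl(\sum_{n=2}^N\lambda_ny_n+(1+\tau_1)\lambda_1x_1\Bigr).$$ Then $\overline x_N\in\operatorname{dom}g$ and, for $x\in\operatorname{dom}g$, $$\Psi(x,\overline x_N)\le\frac{\|x_1-x\|^2+\alpha\|x_1-y_0\|^2+2\lambda_1\tau_1\Psi(x,x_0)}{\overline\lambda_N},$$ where $\Psi(x,y)=\langle F(x),y-x\rangle+g(y)-g(x)$.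
   Context: Notation: $\operatorname{dom} g=\{x: g(x)<\infty\}$; $\delta_C$ is the indicator function of $C$ ($0$ on $C$, $+\infty$ outside); $\operatorname{prox}_{g}(y)=\operatorname{argmin}_{x}\{g(x)+\frac12\|x-y\|^2\}$; $P_C=\operatorname{prox}_{\delta_C}$ is the metric projection onto $C$. $F$ is monotone if $\langle F(x)-F(y),x-y\rangle\ge0$ for all $x,y$. Algorithm 1 (for $g=\delta_C$). Initialization: $\alpha\in(0,\sqrt2-1)$, $\lambda_{max}>0$, $\sigma\in(0,1)$, $x_1,x_0,y_0\in\mathcal E$, $\lambda_0>0$, $\tau_0=1$. Iteration $n\ge1$: given $x_n,x_{n-1},y_{n-1},\lambda_{n-1},\tau_{n-1}$, run the linesearch: for $i=0,1,2,\dots$ set $\tau_n=\sigma^i$, $y_n=x_n+\tau_n(x_n-x_{n-1})$, and let $\lambda_n$ be the largest number in $\bigl(0,\min\{\frac{1+\tau_{n-1}}{\tau_n}\lambda_{n-1},\lambda_{max}\}\bigr]$ such that $$\|\lambda_nF(y_n)-\lambda_{n-1}\tau_nF(y_{n-1})\|\le\alpha\|y_n-y_{n-1}\|,$$ stopping the linesearch at the first $i$ for which such $\lambda_n$ exists. Then set $x_{n+1}=P_C(x_n-\lambda_nF(y_n))$. Algorithm 2. Initialization: $\alpha\in(0,\sqrt2-1)$, $\lambda_{max}>0$, $\sigma\in(0,1)$, $x_1,x_0,y_0\in\mathcal E$, $\lambda_0>0$, $\tau_0=1$. Iteration $n\ge1$: given $x_n,x_{n-1},y_{n-1},\lambda_{n-1},\tau_{n-1}$,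 run the linesearch: for $i=0,1,2,\dots$ set $\tau_n=\sqrt{1+\tau_{n-1}}\,\sigma^i$ if $\lambda_{n-1}\le\frac12\lambda_{max}$ and $\tau_n=\sigma^i$ otherwise, $y_n=x_n+\tau_n(x_n-x_{n-1})$, $\lambda_n=\tau_n\lambda_{n-1}$, stopping at the first $i$ for which $$\lambda_n\|F(y_n)-F(y_{n-1})\|\le\alpha\|y_n-y_{n-1}\|.$$ Then set $x_{n+1}=\operatorname{prox}_{\lambda_ng}(x_n-\lambda_nF(y_n))$. In both algorithms the linesearch always terminates after finitely many $i$.
   Formalization: As printed the claim fails for arbitrary x_1, so x_1 = prox_{λ_0 g}(x_0 − λ_0 F(y_0)) is assumed; the printed bound also fails when its numerator is negative, so it is proved for nonnegative numerator, and with denominator 2λ̄_N in all cases. *)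

theory Defs
  imports "HOL-Analysis.Analysis"
begin

definition edom :: "('a \<Rightarrow> ereal) \<Rightarrow> 'a set" where
  "edom g = {x. g x < \<infinity>}"

definition proper_fun :: "('a \<Rightarrow> ereal) \<Rightarrow> bool" where
  "proper_fun g \<longleftrightarrow> (\<forall>x. g x \<noteq> -\<infinity>) \<and> edom g \<noteq> {}"

definition lsc_fun :: "('a::metric_space \<Rightarrow> ereal) \<Rightarrow> bool" where
  "lsc_fun g \<longleftrightarrow> (\<forall>x X. X \<longlonglongrightarrow> x \<longrightarrow> g x \<le> liminf (\<lambda>n. g (X n)))"

text \<open>The weights are strictly between \<open>0\<close> and \<open>1\<close>, so the \<^typ>\<open>ereal\<close> convention
  \<open>0 * \<infinity> = 0\<close> never enters.\<close>

definition convex_fun :: "('a::real_vector \<Rightarrow> ereal) \<Rightarrow> bool" where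
  "convex_fun g \<longleftrightarrow> (\<forall>x y. \<forall>t::real. 0 < t \<and> t < 1 \<longrightarrow>
     g ((1 - t) *\<^sub>R x + t *\<^sub>R y) \<le> ereal (1 - t) * g x + ereal t * g y)"

definition indicator_fun :: "'a set \<Rightarrow> 'a \<Rightarrow> ereal" where
  "indicator_fun C x = (if x \<in> C then 0 else \<infinity>)"

definition monotone_op :: "('a::real_inner \<Rightarrow> 'a) \<Rightarrow> bool" where
  "monotone_op F \<longleftrightarrow> (\<forall>x y. (F x - F y) \<bullet> (x - y) \<ge> 0)"

text \<open>\<^const>\<open>local_lipschitz\<close> is about families of maps; here the parameter is a dummy (a single point).\<close>

definition locally_Lipschitz :: "('a::metric_space \<Rightarrow> 'b::metric_space) \<Rightarrow> bool" where
  "locally_Lipschitz F \<longleftrightarrow> local_lipschitz {0::real} UNIV (\<lambda>_. F)"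

definition is_solution :: "('a::real_inner \<Rightarrow> 'a) \<Rightarrow> ('a \<Rightarrow> ereal) \<Rightarrow> 'a \<Rightarrow> bool" where
  "is_solution F g xs \<longleftrightarrow> (\<forall>x. ereal (F xs \<bullet> (x - xs)) + g x - g xs \<ge> 0)"

text \<open>\<open>is_prox g y p\<close> says \<open>p = prox\<^sub>g(y)\<close>.  The proximal map is rendered by its graph, since the
  \<open>argmin\<close> is a single point for proper lower semicontinuous convex \<open>g\<close>.\<close>

definition is_prox :: "('a::real_inner \<Rightarrow> ereal) \<Rightarrow> 'a \<Rightarrow> 'a \<Rightarrow> bool" where
  "is_prox g y p \<longleftrightarrow> is_arg_min (\<lambda>x. g x + ereal (1/2 * (norm (x - y))\<^sup>2)) (\<lambda>_. True) p"

definition is_proj :: "'a::real_inner set \<Rightarrow> 'a \<Rightarrow> 'a \<Rightarrow> bool" where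
  "is_proj C = is_prox (indicator_fun C)"

definition extrapolate :: "real \<Rightarrow> 'a::real_vector \<Rightarrow> 'a \<Rightarrow> 'a" where
  "extrapolate \<tau> u v = u + \<tau> *\<^sub>R (u - v)"

definition admissible_init ::
  "real \<Rightarrow> real \<Rightarrow> real \<Rightarrow> (nat \<Rightarrow> real) \<Rightarrow> (nat \<Rightarrow> real) \<Rightarrow> bool" where
  "admissible_init \<alpha> lmax \<sigma> lam tau \<longleftrightarrow>
     0 < \<alpha> \<and> \<alpha> < sqrt 2 - 1 \<and> 0 < lmax \<and> 0 < \<sigma> \<and> \<sigma> < 1 \<and> 0 < lam 0 \<and> tau 0 = 1"

text \<open>In the linesearch definitions below, \<open>u, v, yp, lp, tp\<close> stand for
  \<open>x\<^sub>n, x\<^sub>n\<^sub>-\<^sub>1, y\<^sub>n\<^sub>-\<^sub>1, \<lambda>\<^sub>n\<^sub>-\<^sub>1, \<tau>\<^sub>n\<^sub>-\<^sub>1\<close>, and \<open>\<tau>\<close> is the trial value of \<open>\<tau>\<^sub>n\<close>.\<close>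

definition steps1 :: "('a::real_inner \<Rightarrow> 'a) \<Rightarrow> real \<Rightarrow> real \<Rightarrow> 'a \<Rightarrow> 'a \<Rightarrow> 'a \<Rightarrow> real \<Rightarrow> real
    \<Rightarrow> real \<Rightarrow> real set" where
  "steps1 F \<alpha> lmax u v yp lp tp \<tau> =
     {l \<in> {0 <.. min ((1 + tp) / \<tau> * lp) lmax}.
        norm (l *\<^sub>R F (extrapolate \<tau> u v) - (lp * \<tau>) *\<^sub>R F yp)
          \<le> \<alpha> * norm (extrapolate \<tau> u v - yp)}"

definition is_largest :: "real set \<Rightarrow> real \<Rightarrow> bool" where
  "is_largest S l \<longleftrightarrow> l \<in> S \<and> (\<forall>k\<in>S. k \<le> l)"

definition algorithm1 :: "('a::real_inner \<Rightarrow> 'a) \<Rightarrow> 'a set \<Rightarrow> real \<Rightarrow> real \<Rightarrow> real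
    \<Rightarrow> (nat \<Rightarrow> 'a) \<Rightarrow> (nat \<Rightarrow> 'a) \<Rightarrow> (nat \<Rightarrow> real) \<Rightarrow> (nat \<Rightarrow> real) \<Rightarrow> bool" where
  "algorithm1 F C \<alpha> lmax \<sigma> x y lam tau \<longleftrightarrow>
     admissible_init \<alpha> lmax \<sigma> lam tau \<and>
     (\<forall>n\<ge>1.
        (let S = (\<lambda>i. steps1 F \<alpha> lmax (x n) (x (n - 1)) (y (n - 1)) (lam (n - 1)) (tau (n - 1))
                        (\<sigma> ^ i))
         in \<exists>i. is_largest (S i) (lam n) \<and> (\<forall>j<i. \<nexists>l. is_largest (S j) l) \<and> tau n = \<sigma> ^ i) \<and>
        y n = extrapolate (tau n) (x n) (x (n - 1)) \<and>
        is_proj C (x n - lam n *\<^sub>R F (y n)) (x (n + 1)))"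

definition accepted2 :: "('a::real_inner \<Rightarrow> 'a) \<Rightarrow> real \<Rightarrow> 'a \<Rightarrow> 'a \<Rightarrow> 'a \<Rightarrow> real
    \<Rightarrow> real \<Rightarrow> bool" where
  "accepted2 F \<alpha> u v yp lp \<tau> \<longleftrightarrow>
     \<tau> * lp * norm (F (extrapolate \<tau> u v) - F yp) \<le> \<alpha> * norm (extrapolate \<tau> u v - yp)"

definition trial2 :: "real \<Rightarrow> real \<Rightarrow> real \<Rightarrow> real \<Rightarrow> nat \<Rightarrow> real" where
  "trial2 lmax \<sigma> lp tp i = (if lp \<le> 1/2 * lmax then sqrt (1 + tp) * \<sigma> ^ i else \<sigma> ^ i)"

definition algorithm2 :: "('a::real_inner \<Rightarrow> 'a) \<Rightarrow> ('a \<Rightarrow> ereal) \<Rightarrow> real \<Rightarrow> real \<Rightarrow> real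
    \<Rightarrow> (nat \<Rightarrow> 'a) \<Rightarrow> (nat \<Rightarrow> 'a) \<Rightarrow> (nat \<Rightarrow> real) \<Rightarrow> (nat \<Rightarrow> real) \<Rightarrow> bool" where
  "algorithm2 F g \<alpha> lmax \<sigma> x y lam tau \<longleftrightarrow>
     admissible_init \<alpha> lmax \<sigma> lam tau \<and>
     (\<forall>n\<ge>1.
        (let t = trial2 lmax \<sigma> (lam (n - 1)) (tau (n - 1));
             ok = (\<lambda>i. accepted2 F \<alpha> (x n) (x (n - 1)) (y (n - 1)) (lam (n - 1)) (t i))
         in \<exists>i. ok i \<and> (\<forall>j<i. \<not> ok j) \<and> tau n = t i) \<and>
        lam n = tau n * lam (n - 1) \<and>
        y n = extrapolate (tau n) (x n) (x (n - 1)) \<and>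
        is_prox (\<lambda>z. ereal (lam n) * g z) (x n - lam n *\<^sub>R F (y n)) (x (n + 1)))"

definition lam_bar :: "(nat \<Rightarrow> real) \<Rightarrow> (nat \<Rightarrow> real) \<Rightarrow> nat \<Rightarrow> real" where
  "lam_bar lam tau N = (\<Sum>n=1..N. lam n) + tau 1 * lam 1"

definition x_bar :: "(nat \<Rightarrow> 'a::real_vector) \<Rightarrow> (nat \<Rightarrow> 'a) \<Rightarrow> (nat \<Rightarrow> real) \<Rightarrow> (nat \<Rightarrow> real)
    \<Rightarrow> nat \<Rightarrow> 'a" where
  "x_bar x y lam tau N = (1 / lam_bar lam tau N) *\<^sub>R
     ((\<Sum>n=2..N. lam n *\<^sub>R y n) + ((1 + tau 1) * lam 1) *\<^sub>R x 1)"

text \<open>\<open>Psi F g x y\<close> is meant for \<open>x \<in> edom g\<close> and \<open>g\<close> proper; its value is \<open>\<infinity>\<close> if \<open>y \<notin> edom g\<close>.\<close>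

definition Psi :: "('a::real_inner \<Rightarrow> 'a) \<Rightarrow> ('a \<Rightarrow> ereal) \<Rightarrow> 'a \<Rightarrow> 'a \<Rightarrow> ereal" where
  "Psi F g x y = ereal (F x \<bullet> (y - x)) + g y - g x"

end

theory Submission
  imports Defs
begin

text \<open>
  The optimality conditions of two consecutive proximal steps, the older one tested at
  \<open>x\<^sub>n\<^sub>+\<^sub>1\<close> with weight \<open>\<tau>\<^sub>n\<close> and at \<open>x\<^sub>n\<^sub>-\<^sub>1\<close> with weight \<open>\<tau>\<^sub>n\<^sup>2\<close>, combine with the linesearch
  inequality and monotonicity to an energy estimate for
  \<open>\<parallel>x\<^sub>n - z\<parallel>\<^sup>2 + \<alpha> \<parallel>x\<^sub>n - y\<^sub>n\<^sub>-\<^sub>1\<parallel>\<^sup>2\<close>.  Both linesearches guarantee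
  \<open>\<lambda>\<^sub>n \<tau>\<^sub>n \<le> (1 + \<tau>\<^sub>n\<^sub>-\<^sub>1) \<lambda>\<^sub>n\<^sub>-\<^sub>1\<close>, so that after summation by parts the ergodic average is a convex
  combination of \<open>x\<^sub>1, \<dots>, x\<^sub>N\<close> (the \<open>y\<^sub>n\<close> themselves may leave the domain of \<open>g\<close>); Jensen's
  inequality then bounds \<open>g\<close> at the average by the telescoped sum.
\<close>

section \<open>Convexity and first-order optimality of proximal points\<close>

lemma nonneg_if_affine_nonneg:
  fixes a b :: real
  assumes "\<And>t. 0 < t \<Longrightarrow> t < 1 \<Longrightarrow> 0 \<le> a + t * b"
  shows "0 \<le> a"
proof (rule tendsto_lowerbound)
  show "((\<lambda>t. a + t * b) \<longlongrightarrow> a) (at_right 0)"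
    by (auto intro!: tendsto_eq_intros)
  show "\<forall>\<^sub>F t in at_right 0. 0 \<le> a + t * b"
    using assms by (auto simp: eventually_at_right_field intro!: exI[of _ 1])
qed simp

lemma proper_fun_finite:
  assumes "proper_fun g" "z \<in> edom g"
  obtains r where "g z = ereal r"
  using assms unfolding proper_fun_def edom_def by (cases "g z") auto

lemma proper_convex_combination:
  fixes g :: "'a::real_vector \<Rightarrow> ereal"
  assumes "proper_fun g" "convex_fun g" "u \<in> edom g" "v \<in> edom g" "0 < t" "t < 1"
  shows "(1 - t) *\<^sub>R u + t *\<^sub>R v \<in> edom g"
    and "real_of_ereal (g ((1 - t) *\<^sub>R u + t *\<^sub>R v))
           \<le> (1 - t) * real_of_ereal (g u) + t * real_of_ereal (g v)"
proof -
  let ?w = "(1 - t) *\<^sub>R u + t *\<^sub>R v"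
  obtain a b where ab: "g u = ereal a" "g v = ereal b"
    using proper_fun_finite assms by metis
  have le: "g ?w \<le> ereal ((1 - t) * a + t * b)"
    using assms ab unfolding convex_fun_def by (metis plus_ereal.simps(1) times_ereal.simps(1))
  then show w: "?w \<in> edom g"
    unfolding edom_def by auto
  from proper_fun_finite[OF \<open>proper_fun g\<close> w] obtain c where "g ?w = ereal c" .
  with le ab show "real_of_ereal (g ?w) \<le> (1 - t) * real_of_ereal (g u) + t * real_of_ereal (g v)"
    by simp
qed

lemma convex_on_edom:
  fixes g :: "'a::real_vector \<Rightarrow> ereal"
  assumes "proper_fun g" "convex_fun g"
  shows "convex_on (edom g) (\<lambda>z. real_of_ereal (g z))"
proof (rule convex_onI)
  show "convex (edom g)"
    unfolding convex_alt
  proof (intro ballI allI impI)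
    fix u v and t :: real
    assume "u \<in> edom g" "v \<in> edom g" "0 \<le> t \<and> t \<le> 1"
    then show "(1 - t) *\<^sub>R u + t *\<^sub>R v \<in> edom g"
      using proper_convex_combination(1)[OF assms, of u v t] by (cases "t = 0 \<or> t = 1") auto
  qed
qed (rule proper_convex_combination(2)[OF assms])

text \<open>Any point of the nonempty domain has a finite objective value and would beat a minimizer
  at which \<open>g\<close> is infinite.\<close>

lemma is_prox_in_edom:
  assumes "proper_fun g" "0 < l" "is_prox (\<lambda>z. ereal l * g z) u p"
  shows "p \<in> edom g"
proof (rule ccontr)
  assume "p \<notin> edom g"
  then have p: "g p = \<infinity>" by (simp add: edom_def)
  obtain z where z: "z \<in> edom g" using assms(1) by (auto simp: proper_fun_def)
  obtain r where r: "g z = ereal r" using proper_fun_finite[OF assms(1) z] .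
  have "ereal l * g z + ereal (1/2 * (norm (z - u))\<^sup>2) < ereal l * g p + ereal (1/2 * (norm (p - u))\<^sup>2)"
    using p r \<open>0 < l\<close> by simp
  with assms(3) show False
    unfolding is_prox_def is_arg_min_def by blast
qed

text \<open>This says that \<open>u - p\<close> lies in \<open>l\<close> times the subdifferential
  of \<open>g\<close> at \<open>p\<close>. Compare \<open>p\<close> with a point \<open>?w\<close>
  of the segment towards \<open>z\<close>, divide by \<open>t\<close> and let \<open>t\<close> tend
  to 0.\<close>

lemma is_prox_variational:
  fixes g :: "'a::real_inner \<Rightarrow> ereal"
  assumes "proper_fun g" "convex_fun g" "0 < l" "is_prox (\<lambda>z. ereal l * g z) u p" "z \<in> edom g"
  shows "l * (real_of_ereal (g p) - real_of_ereal (g z)) \<le> (p - u) \<bullet> (z - p)"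
proof -
  let ?h = "\<lambda>z. real_of_ereal (g z)"
  have p: "p \<in> edom g"
    using is_prox_in_edom assms by blast
  have "0 \<le> (p - u) \<bullet> (z - p) + l * (?h z - ?h p) + t * ((norm (z - p))\<^sup>2 / 2)"
    if t: "0 < t" "t < 1" for t
  proof -
    let ?w = "(1 - t) *\<^sub>R p + t *\<^sub>R z"
    note w = proper_convex_combination[OF assms(1,2) p assms(5) t]
    have "ereal l * g p + ereal (1/2 * (norm (p - u))\<^sup>2) \<le> ereal l * g ?w + ereal (1/2 * (norm (?w - u))\<^sup>2)"
      using assms(4) unfolding is_prox_def is_arg_min_def by (meson not_less)
    moreover obtain a b where "g p = ereal a" "g ?w = ereal b"
      using proper_fun_finite[OF assms(1)] p w(1) by metis
    ultimately have "l * ?h p + 1/2 * (norm (p - u))\<^sup>2 \<le> l * ?h ?w + 1/2 * (norm (?w - u))\<^sup>2"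
      by simp
    moreover have "l * ?h ?w \<le> l * ((1 - t) * ?h p + t * ?h z)"
      using w(2) \<open>0 < l\<close> by simp
    moreover have "(norm (?w - u))\<^sup>2 = (norm (p - u))\<^sup>2 + 2 * t * ((p - u) \<bullet> (z - p)) + t\<^sup>2 * (norm (z - p))\<^sup>2"
      unfolding power2_norm_eq_inner unfolding power2_eq_square
      by (simp add: algebra_simps inner_commute)
    ultimately have "0 \<le> t * ((p - u) \<bullet> (z - p) + l * (?h z - ?h p) + t * ((norm (z - p))\<^sup>2 / 2))"
      by (simp add: algebra_simps power2_eq_square)
    with t show ?thesis by (simp add: zero_le_mult_iff)
  qed
  from nonneg_if_affine_nonneg[OF this] show ?thesis
    by (simp add: algebra_simps)
qed

section \<open>One-step energy estimate\<close>

text \<open>In \<open>energy_step\<close>, \<open>q\<close> is an inner product and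
  \<open>p\<close>, \<open>a\<close>, \<open>b\<close>, \<open>c\<close> are the norms of
  \<open>w - w'\<close>, \<open>w - u\<close>, \<open>u - w'\<close>, \<open>w - u'\<close>. The
  coefficients fit because \<open>1 + sqrt 2\<close> is the reciprocal of
  \<open>sqrt 2 - 1\<close>.\<close>

lemma extrapolation_cross_term:
  fixes p q a b c :: real
  assumes "0 \<le> \<alpha>" "\<alpha> \<le> sqrt 2 - 1" "0 \<le> p" "p \<le> a + b" "0 \<le> c" "q \<le> \<alpha> * p * c"
  shows "2 * q \<le> a\<^sup>2 + \<alpha> * b\<^sup>2 + (1 - \<alpha>) * c\<^sup>2"
proof -
  define s :: real where "s = sqrt 2"
  have s: "s * s = 2" "0 < s" by (simp_all add: s_def)
  have "p * c \<le> (a + b) * c"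
    using assms by (simp add: mult_right_mono)
  moreover have "2 * ((a + b) * c) \<le> (1 + s) * a\<^sup>2 + b\<^sup>2 + s * c\<^sup>2"
  proof -
    \<comment> \<open>AM-GM on both products: \<open>2 v c \<le> v\<^sup>2 / s + s c\<^sup>2\<close> with \<open>v = a + b\<close>, and \<open>2 a b \<le> (1 + s) a\<^sup>2 + (s - 1) b\<^sup>2\<close>.\<close>
    have "0 \<le> (s * c - (a + b))\<^sup>2 + (a - (s - 1) * b)\<^sup>2 * (1 + s)" using s by simp
    \<comment> \<open>A polynomial identity valid for every \<open>s\<close>; its first summand
      vanishes since \<open>s * s = 2\<close>.\<close>
    also have "\<dots> = (s * s - 2) * ((s - 1) * b\<^sup>2 - a\<^sup>2 - 2 * a * b)
        + s * ((1 + s) * a\<^sup>2 + b\<^sup>2 + s * c\<^sup>2 - 2 * ((a + b) * c))"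
      by (simp add: algebra_simps power2_eq_square)
    finally show ?thesis using s by (simp add: zero_le_mult_iff)
  qed
  ultimately have "2 * (p * c) \<le> (1 + s) * a\<^sup>2 + b\<^sup>2 + s * c\<^sup>2" by linarith
  from mult_left_mono[OF this \<open>0 \<le> \<alpha>\<close>] assms(6)
  have "2 * q \<le> (\<alpha> * (1 + s)) * a\<^sup>2 + \<alpha> * b\<^sup>2 + (\<alpha> * s) * c\<^sup>2"
    by (simp add: algebra_simps)
  moreover have le1: "\<alpha> * (1 + s) \<le> 1"
    using mult_right_mono[OF assms(2), of "1 + s"] s by (simp add: s_def algebra_simps)
  moreover have "(\<alpha> * (1 + s)) * a\<^sup>2 \<le> 1 * a\<^sup>2"
    by (intro mult_right_mono le1) simp
  moreover have "(\<alpha> * s) * c\<^sup>2 \<le> (1 - \<alpha>) * c\<^sup>2"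
    using le1 by (intro mult_right_mono) (simp_all add: algebra_simps)
  ultimately show ?thesis by linarith
qed

text \<open>Read \<open>u\<close>, \<open>u'\<close>, \<open>w\<close>, \<open>w'\<close> as
  \<open>x n\<close>, \<open>x (n + 1)\<close>, \<open>y n\<close>, \<open>y (n - 1)\<close>,
  \<open>m\<close> as \<open>tau n * lam (n - 1)\<close>, and \<open>f\<close>, \<open>f'\<close>,
  \<open>f0\<close> as \<open>F\<close> at \<open>w\<close>, \<open>w'\<close>, \<open>z\<close>.
  Add \<open>new\<close> and \<open>old\<close>, then bound the remaining cross term by
  Cauchy-Schwarz and \<open>search\<close>.\<close>

lemma energy_step:
  fixes u u' v w w' z f f' f0 :: "'a::real_inner"
  assumes \<alpha>: "0 \<le> \<alpha>" "\<alpha> \<le> sqrt 2 - 1" and l: "0 \<le> l"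
    and new: "l * (gu' - gz) \<le> (u' - u + l *\<^sub>R f) \<bullet> (z - u')"
    and old: "l * ((1 + t) * gu - gu' - t * gv) \<le> (w - u + m *\<^sub>R f') \<bullet> (u' - w)"
    and search: "norm (l *\<^sub>R f - m *\<^sub>R f') \<le> \<alpha> * norm (w - w')"
    and mono: "(f - f0) \<bullet> (w - z) \<ge> 0"
  shows "(norm (u' - z))\<^sup>2 + \<alpha> * (norm (u' - w))\<^sup>2
           + 2 * (l * (f0 \<bullet> (w - z) + (1 + t) * gu - t * gv - gz))
         \<le> (norm (u - z))\<^sup>2 + \<alpha> * (norm (u - w'))\<^sup>2"
proof -
  \<comment> \<open>What the \<open>F\<close> terms of \<open>new\<close> and \<open>old\<close>
    leave once the part of \<open>f\<close> against \<open>z - w\<close> is split off for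
    monotonicity.\<close>
  define q where "q = (l *\<^sub>R f - m *\<^sub>R f') \<bullet> (w - u')"
  have "q \<le> norm (l *\<^sub>R f - m *\<^sub>R f') * norm (w - u')"
    unfolding q_def by (rule norm_cauchy_schwarz)
  also have "\<dots> \<le> \<alpha> * norm (w - w') * norm (w - u')"
    by (rule mult_right_mono[OF search]) simp
  finally have "2 * q \<le> (norm (w - u))\<^sup>2 + \<alpha> * (norm (u - w'))\<^sup>2 + (1 - \<alpha>) * (norm (w - u'))\<^sup>2"
    using norm_triangle_ineq[of "w - u" "u - w'"]
    by (intro extrapolation_cross_term[OF \<alpha>, of "norm (w - w')"]) simp_all
  moreover have "0 \<le> l * ((f - f0) \<bullet> (w - z))"
    using l mono by simp
  moreover have "(u' - u + l *\<^sub>R f) \<bullet> (z - u') + (w - u + m *\<^sub>R f') \<bullet> (u' - w)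
      = (u' - u) \<bullet> (z - u') + (w - u) \<bullet> (u' - w) + q - l * ((f - f0) \<bullet> (w - z)) - l * (f0 \<bullet> (w - z))"
    unfolding q_def by (simp add: algebra_simps inner_commute)
  \<comment> \<open>Three-point identities: the squares of \<open>u' - u\<close> cancel in the sum,
    and that of \<open>w - u\<close> absorbs the one in the bound on \<open>2 * q\<close>.\<close>
  moreover have "2 * ((u' - u) \<bullet> (z - u')) = (norm (u - z))\<^sup>2 - (norm (u' - u))\<^sup>2 - (norm (u' - z))\<^sup>2"
    and "2 * ((w - u) \<bullet> (u' - w)) = (norm (u' - u))\<^sup>2 - (norm (w - u))\<^sup>2 - (norm (u' - w))\<^sup>2"
    unfolding power2_norm_eq_inner by (simp_all add: algebra_simps inner_commute)
  ultimately show ?thesis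
    using new old by (simp add: algebra_simps norm_minus_commute)
qed

section \<open>Weights of the ergodic average\<close>

text \<open>The coefficient of \<open>x n\<close> after writing each \<open>y k\<close> as
  \<open>(1 + tau k)\<close> times \<open>x k\<close> minus \<open>tau k\<close> times
  \<open>x (k - 1)\<close>: \<open>x n\<close> also occurs in \<open>y (n + 1)\<close>, except when
  \<open>n = N\<close>.\<close>

definition ergodic_weight :: "(nat \<Rightarrow> real) \<Rightarrow> (nat \<Rightarrow> real) \<Rightarrow> nat \<Rightarrow> nat \<Rightarrow> real" where
  "ergodic_weight lam tau N n =
     (1 + tau n) * lam n - (if n < N then lam (Suc n) * tau (Suc n) else 0)"

text \<open>Kept general in \<open>f\<close> because it serves for the iterates, for the constant 1
  and for the values of \<open>g\<close>.\<close>

lemma ergodic_summation_by_parts: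
  fixes f :: "nat \<Rightarrow> 'a::real_vector"
  assumes "1 \<le> N"
  shows "(\<Sum>n=1..N. ergodic_weight lam tau N n *\<^sub>R f n)
     = (\<Sum>n=2..N. lam n *\<^sub>R ((1 + tau n) *\<^sub>R f n - tau n *\<^sub>R f (n - 1))) + ((1 + tau 1) * lam 1) *\<^sub>R f 1"
  using assms
proof (induction N rule: dec_induct)
  case base
  then show ?case by (simp add: ergodic_weight_def)
next
  case (step N)
  \<comment> \<open>Raising \<open>N\<close> by one changes, among the old indices, only the weight
    of \<open>N\<close>.\<close>
  have "(\<Sum>n=1..N. ergodic_weight lam tau (Suc N) n *\<^sub>R f n)
     = (\<Sum>n=1..N. ergodic_weight lam tau N n *\<^sub>R f n) - (lam (Suc N) * tau (Suc N)) *\<^sub>R f N"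
  proof -
    have "{1..N} = insert N {1..<N}" using step by auto
    moreover have "(\<Sum>n=1..<N. ergodic_weight lam tau (Suc N) n *\<^sub>R f n)
       = (\<Sum>n=1..<N. ergodic_weight lam tau N n *\<^sub>R f n)"
      by (rule sum.cong) (auto simp: ergodic_weight_def)
    ultimately show ?thesis
      by (simp add: ergodic_weight_def algebra_simps)
  qed
  then show ?case
    using step by (simp add: ergodic_weight_def algebra_simps)
qed

lemma sum_ergodic_weight:
  assumes "1 \<le> N"
  shows "(\<Sum>n=1..N. ergodic_weight lam tau N n) = lam_bar lam tau N"
proof -
  have "(\<Sum>n=1..N. lam n) = lam 1 + (\<Sum>n=2..N. lam n)"
    using assms by (simp add: sum.atLeast_Suc_atMost numeral_2_eq_2)
  with ergodic_summation_by_parts[OF assms, of lam tau "\<lambda>_. 1 :: real"] show ?thesis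
    by (simp add: lam_bar_def algebra_simps)
qed

section \<open>Analysis common to both algorithms\<close>

locale extrapolated_prox_gradient =
  fixes F :: "'a::real_inner \<Rightarrow> 'a" and g :: "'a \<Rightarrow> ereal"
    and x y :: "nat \<Rightarrow> 'a" and lam tau :: "nat \<Rightarrow> real" and \<alpha> :: real
  assumes mono: "monotone_op F" and proper: "proper_fun g" and conv: "convex_fun g"
    and \<alpha>: "0 \<le> \<alpha>" "\<alpha> \<le> sqrt 2 - 1"
    and lam_pos: "\<And>n. 0 < lam n" and tau_pos: "\<And>n. 0 < tau n"
    and step_growth: "\<And>n. lam (Suc n) * tau (Suc n) \<le> (1 + tau n) * lam n"
    and y_Suc: "\<And>n. y (Suc n) = extrapolate (tau (Suc n)) (x (Suc n)) (x n)"
    and search: "\<And>n. norm (lam (Suc n) *\<^sub>R F (y (Suc n)) - (tau (Suc n) * lam n) *\<^sub>R F (y n))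
                   \<le> \<alpha> * norm (y (Suc n) - y n)"
    and prox: "\<And>n. is_prox (\<lambda>z. ereal (lam n) * g z) (x n - lam n *\<^sub>R F (y n)) (x (Suc n))"
    \<comment> \<open>Holds trivially for indicator functions, and in Algorithm 2 by the choice of \<open>\<lambda>\<^sub>n\<close>.\<close>
    and scale: "\<And>n u v. u \<in> edom g \<Longrightarrow> v \<in> edom g \<Longrightarrow>
      lam (Suc n) * (real_of_ereal (g u) - real_of_ereal (g v))
      = tau (Suc n) * lam n * (real_of_ereal (g u) - real_of_ereal (g v))"
begin

abbreviation h :: "'a \<Rightarrow> real" where
  "h z \<equiv> real_of_ereal (g z)"

lemma x_Suc_in_edom: "x (Suc n) \<in> edom g"
  using is_prox_in_edom[OF proper lam_pos prox] .

lemma prox_step: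
  "z \<in> edom g \<Longrightarrow> lam n * (h (x (Suc n)) - h z) \<le> (x (Suc n) - x n + lam n *\<^sub>R F (y n)) \<bullet> (z - x (Suc n))"
  using is_prox_variational[OF proper conv lam_pos prox] by (simp add: algebra_simps)

text \<open>With \<open>d\<close> the vector \<open>?d\<close>, \<open>t\<close> times
  \<open>d\<close> is the left factor on the right-hand side, and the two test directions with
  weights \<open>t\<close> and \<open>t * t\<close> add up to \<open>t\<close> times
  \<open>x (n + 2) - y (n + 1)\<close>.\<close>

lemma prox_step_extrapolated:
  fixes n :: nat
  assumes "x n \<in> edom g"
  defines "t \<equiv> tau (Suc n)"
  shows "lam (Suc n) * ((1 + t) * h (x (Suc n)) - h (x (Suc (Suc n))) - t * h (x n))
    \<le> (y (Suc n) - x (Suc n) + (t * lam n) *\<^sub>R F (y n)) \<bullet> (x (Suc (Suc n)) - y (Suc n))"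
proof -
  let ?d = "x (Suc n) - x n + lam n *\<^sub>R F (y n)"
  have t: "0 < t" by (simp add: t_def tau_pos)
  have "lam (Suc n) * ((1 + t) * h (x (Suc n)) - h (x (Suc (Suc n))) - t * h (x n))
      = lam (Suc n) * (h (x (Suc n)) - h (x (Suc (Suc n)))) + t * (lam (Suc n) * (h (x (Suc n)) - h (x n)))"
    by (simp add: algebra_simps)
  also have "\<dots> = t * (lam n * (h (x (Suc n)) - h (x (Suc (Suc n))))) + t * t * (lam n * (h (x (Suc n)) - h (x n)))"
    unfolding t_def scale[OF x_Suc_in_edom x_Suc_in_edom] scale[OF x_Suc_in_edom assms(1)]
    by (simp only: mult_ac)
  also have "\<dots> \<le> t * (?d \<bullet> (x (Suc (Suc n)) - x (Suc n))) + t * t * (?d \<bullet> (x n - x (Suc n)))"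
    using t by (intro add_mono mult_left_mono prox_step x_Suc_in_edom assms(1)) auto
  also have "\<dots> = (y (Suc n) - x (Suc n) + (t * lam n) *\<^sub>R F (y n)) \<bullet> (x (Suc (Suc n)) - y (Suc n))"
    by (simp add: y_Suc extrapolate_def t_def algebra_simps)
  finally show ?thesis .
qed

text \<open>A finite substitute for \<open>Psi F g z (y n)\<close>: the possibly infinite
  \<open>g (y n)\<close> is replaced by the affine combination of values of \<open>g\<close> that
  mirrors the extrapolation.\<close>

definition gap :: "'a \<Rightarrow> nat \<Rightarrow> real" where
  "gap z n = F z \<bullet> (y n - z) + (1 + tau n) * h (x n) - tau n * h (x (n - 1)) - h z"

lemma energy_decrease:
  assumes "z \<in> edom g" "x n \<in> edom g"
  shows "(norm (x (Suc (Suc n)) - z))\<^sup>2 + \<alpha> * (norm (x (Suc (Suc n)) - y (Suc n)))\<^sup>2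
      + 2 * (lam (Suc n) * gap z (Suc n))
    \<le> (norm (x (Suc n) - z))\<^sup>2 + \<alpha> * (norm (x (Suc n) - y n))\<^sup>2"
  unfolding gap_def diff_Suc_1
  by (rule energy_step[OF \<alpha> less_imp_le[OF lam_pos] prox_step[OF assms(1)]
        prox_step_extrapolated[OF assms(2)] search])
     (use mono in \<open>simp add: monotone_op_def\<close>)

lemma sum_gap_le:
  assumes "z \<in> edom g" "x 0 \<in> edom g"
  shows "2 * (\<Sum>n=1..N. lam n * gap z n) \<le> (norm (x 1 - z))\<^sup>2 + \<alpha> * (norm (x 1 - y 0))\<^sup>2"
proof -
  have x: "x n \<in> edom g" for n
    using assms(2) x_Suc_in_edom by (cases n) auto
  have "(norm (x (Suc N) - z))\<^sup>2 + \<alpha> * (norm (x (Suc N) - y N))\<^sup>2 + 2 * (\<Sum>n=1..N. lam n * gap z n)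
      \<le> (norm (x 1 - z))\<^sup>2 + \<alpha> * (norm (x 1 - y 0))\<^sup>2"
  proof (induction N)
    case (Suc N)
    with energy_decrease[OF assms(1) x, of N] show ?case by (simp add: distrib_left)
  qed simp
  moreover have "0 \<le> (norm (x (Suc N) - z))\<^sup>2 + \<alpha> * (norm (x (Suc N) - y N))\<^sup>2"
    using \<alpha> by simp
  ultimately show ?thesis by linarith
qed

text \<open>For \<open>n < N\<close> this is exactly \<open>step_growth\<close>.\<close>

lemma ergodic_weight_nonneg: "0 \<le> ergodic_weight lam tau N n"
  using step_growth[of n] lam_pos[of n] tau_pos[of n] by (simp add: ergodic_weight_def)

lemma lam_bar_pos: "0 < lam_bar lam tau N"
  unfolding lam_bar_def
  using lam_pos tau_pos by (intro add_nonneg_pos sum_nonneg mult_pos_pos) (simp_all add: less_imp_le)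

text \<open>The sum over \<open>y\<close> starts at 2, so \<open>x 0\<close>, which may lie outside
  the domain, does not occur.\<close>

lemma x_bar_eq:
  assumes "1 \<le> N"
  shows "x_bar x y lam tau N = (\<Sum>n=1..N. (ergodic_weight lam tau N n / lam_bar lam tau N) *\<^sub>R x n)"
proof -
  have y: "(\<Sum>n=2..N. lam n *\<^sub>R y n) = (\<Sum>n=2..N. lam n *\<^sub>R ((1 + tau n) *\<^sub>R x n - tau n *\<^sub>R x (n - 1)))"
  proof (rule sum.cong)
    fix n assume "n \<in> {2..N}"
    then show "lam n *\<^sub>R y n = lam n *\<^sub>R ((1 + tau n) *\<^sub>R x n - tau n *\<^sub>R x (n - 1))"
      by (cases n) (simp_all add: y_Suc extrapolate_def algebra_simps)
  qed simp
  show ?thesis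
    unfolding x_bar_def y ergodic_summation_by_parts[OF assms, symmetric]
    by (simp add: scaleR_sum_right)
qed

lemma
  assumes "1 \<le> N"
  shows x_bar_in_edom: "x_bar x y lam tau N \<in> edom g"
    and ergodic_jensen: "lam_bar lam tau N * h (x_bar x y lam tau N)
      \<le> (\<Sum>n=2..N. lam n * ((1 + tau n) * h (x n) - tau n * h (x (n - 1)))) + (1 + tau 1) * lam 1 * h (x 1)"
proof -
  let ?a = "\<lambda>n. ergodic_weight lam tau N n / lam_bar lam tau N"
  have a: "(\<Sum>n=1..N. ?a n) = 1" "\<And>n. 0 \<le> ?a n"
    using lam_bar_pos[of N] ergodic_weight_nonneg
    by (simp_all add: sum_ergodic_weight[OF assms, simplified] flip: sum_divide_distrib)
  have x: "x n \<in> edom g" if "n \<in> {1..N}" for n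
    using that x_Suc_in_edom[of "n - 1"] by simp
  have C: "convex_on (edom g) h" by (rule convex_on_edom[OF proper conv])
  show "x_bar x y lam tau N \<in> edom g"
    unfolding x_bar_eq[OF assms]
    using C a x by (intro convex_sum) (auto simp: convex_on_def)
  have "h (x_bar x y lam tau N) \<le> (\<Sum>n=1..N. ?a n * h (x n))"
    unfolding x_bar_eq[OF assms]
    using C a x assms by (intro convex_on_sum) auto
  also have "\<dots> = (\<Sum>n=1..N. ergodic_weight lam tau N n * h (x n)) / lam_bar lam tau N"
    by (simp add: sum_divide_distrib)
  finally have "lam_bar lam tau N * h (x_bar x y lam tau N) \<le> (\<Sum>n=1..N. ergodic_weight lam tau N n * h (x n))"
    using lam_bar_pos[of N] by (simp add: pos_le_divide_eq mult.commute)
  then show "lam_bar lam tau N * h (x_bar x y lam tau N)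
      \<le> (\<Sum>n=2..N. lam n * ((1 + tau n) * h (x n) - tau n * h (x (n - 1)))) + (1 + tau 1) * lam 1 * h (x 1)"
    using ergodic_summation_by_parts[OF assms, of lam tau "\<lambda>n. h (x n)"] by simp
qed

lemma ergodic_bound:
  assumes "1 \<le> N" "z \<in> edom g" "x 0 \<in> edom g"
  shows "2 * (lam_bar lam tau N * (F z \<bullet> (x_bar x y lam tau N - z) + h (x_bar x y lam tau N) - h z))
    \<le> (norm (x 1 - z))\<^sup>2 + \<alpha> * (norm (x 1 - y 0))\<^sup>2
      + 2 * lam 1 * tau 1 * (F z \<bullet> (x 0 - z) + h (x 0) - h z)"
proof -
  let ?L = "lam_bar lam tau N" and ?xb = "x_bar x y lam tau N"
  let ?G = "\<lambda>n. (1 + tau n) * h (x n) - tau n * h (x (n - 1))"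
  have L: "?L = (\<Sum>n=2..N. lam n) + (1 + tau 1) * lam 1"
    using assms(1) by (simp add: lam_bar_def sum.atLeast_Suc_atMost numeral_2_eq_2 algebra_simps)
  have "F z \<bullet> (?L *\<^sub>R ?xb) = (\<Sum>n=2..N. lam n * (F z \<bullet> y n)) + (1 + tau 1) * lam 1 * (F z \<bullet> x 1)"
    using lam_bar_pos[of N] by (simp add: x_bar_def inner_add_right inner_sum_right)
  then have xb: "?L * (F z \<bullet> ?xb) = (\<Sum>n=2..N. lam n * (F z \<bullet> y n)) + (1 + tau 1) * lam 1 * (F z \<bullet> x 1)"
    by simp
  have "(\<Sum>n=1..N. lam n * gap z n) = lam 1 * gap z 1 + (\<Sum>n=2..N. lam n * gap z n)"
    using assms(1) by (simp add: sum.atLeast_Suc_atMost numeral_2_eq_2)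
  also have "(\<Sum>n=2..N. lam n * gap z n) = (\<Sum>n=2..N. lam n * (F z \<bullet> y n)) + (\<Sum>n=2..N. lam n * ?G n)
      - (\<Sum>n=2..N. lam n) * (F z \<bullet> z + h z)"
    unfolding gap_def sum_distrib_right sum.distrib[symmetric] sum_subtractf[symmetric]
    by (rule sum.cong) (simp_all add: algebra_simps)
  \<comment> \<open>Extrapolation at \<open>n = 1\<close> involves \<open>x 0\<close>; its share
    becomes the \<open>Psi F g z (x 0)\<close> term of the final bound.\<close>
  also have "lam 1 * gap z 1 = (1 + tau 1) * lam 1 * (F z \<bullet> x 1) + (1 + tau 1) * lam 1 * h (x 1)
      - (1 + tau 1) * lam 1 * (F z \<bullet> z + h z) - lam 1 * tau 1 * (F z \<bullet> (x 0 - z) + h (x 0) - h z)"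
    by (simp add: gap_def y_Suc extrapolate_def algebra_simps)
  finally have "(\<Sum>n=1..N. lam n * gap z n)
      = ?L * (F z \<bullet> ?xb) + ((\<Sum>n=2..N. lam n * ?G n) + (1 + tau 1) * lam 1 * h (x 1))
        - ?L * (F z \<bullet> z + h z) - lam 1 * tau 1 * (F z \<bullet> (x 0 - z) + h (x 0) - h z)"
    unfolding xb unfolding L by (simp add: algebra_simps)
  then have "?L * (F z \<bullet> (?xb - z) + h ?xb - h z) - lam 1 * tau 1 * (F z \<bullet> (x 0 - z) + h (x 0) - h z)
      \<le> (\<Sum>n=1..N. lam n * gap z n)"
    using ergodic_jensen[OF assms(1)] by (simp add: algebra_simps)
  with sum_gap_le[OF assms(2,3), of N] show ?thesis by linarith
qed

text \<open>If \<open>x 0\<close> is outside the domain, \<open>R\<close> is infinite; otherwise all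
  values are real and \<open>ergodic_bound\<close> applies.\<close>

lemma Psi_x_bar_le:
  assumes "1 \<le> N" "z \<in> edom g"
  defines "R \<equiv> ereal ((norm (x 1 - z))\<^sup>2 + \<alpha> * (norm (x 1 - y 0))\<^sup>2) + ereal (2 * lam 1 * tau 1) * Psi F g z (x 0)"
  shows "Psi F g z (x_bar x y lam tau N) \<le> R / ereal (2 * lam_bar lam tau N)"
proof (cases "x 0 \<in> edom g")
  case True
  let ?xb = "x_bar x y lam tau N"
  obtain a b c where "g ?xb = ereal a" "g z = ereal b" "g (x 0) = ereal c"
    using proper_fun_finite[OF proper] x_bar_in_edom[OF assms(1)] assms(2) True by metis
  have "F z \<bullet> (?xb - z) + h ?xb - h z
      \<le> ((norm (x 1 - z))\<^sup>2 + \<alpha> * (norm (x 1 - y 0))\<^sup>2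
          + 2 * lam 1 * tau 1 * (F z \<bullet> (x 0 - z) + h (x 0) - h z)) / (2 * lam_bar lam tau N)"
    using ergodic_bound[OF assms(1,2) True] lam_bar_pos[of N]
    by (simp add: pos_le_divide_eq mult_ac)
  with \<open>g ?xb = ereal a\<close> \<open>g z = ereal b\<close> \<open>g (x 0) = ereal c\<close> show ?thesis
    using lam_bar_pos[of N] by (simp add: R_def Psi_def)
next
  case False
  then have "Psi F g z (x 0) = \<infinity>"
    unfolding Psi_def using proper_fun_finite[OF proper assms(2)] by (auto simp: edom_def)
  then have "R = \<infinity>"
    using lam_pos[of 1] tau_pos[of 1] by (simp add: R_def)
  then show ?thesis using lam_bar_pos[of N] by simp
qed

end

section \<open>Both algorithms as instances\<close>

lemma algorithm1_extrapolated_prox_gradient: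
  fixes F :: "'a::real_inner \<Rightarrow> 'a"
  assumes "monotone_op F" "proper_fun (indicator_fun C)" "convex_fun (indicator_fun C)"
    and alg: "algorithm1 F C \<alpha> lmax \<sigma> x y lam tau"
    and start: "is_prox (\<lambda>z. ereal (lam 0) * indicator_fun C z) (x 0 - lam 0 *\<^sub>R F (y 0)) (x 1)"
  shows "extrapolated_prox_gradient F (indicator_fun C) x y lam tau \<alpha>"
proof -
  have init: "0 < \<alpha>" "\<alpha> < sqrt 2 - 1" "0 < \<sigma>" "0 < lam 0" "tau 0 = 1"
    using alg by (auto simp: algorithm1_def admissible_init_def)
  have step: "\<exists>i. tau (Suc n) = \<sigma> ^ i"
    "lam (Suc n) \<in> steps1 F \<alpha> lmax (x (Suc n)) (x n) (y n) (lam n) (tau n) (tau (Suc n))"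
    "y (Suc n) = extrapolate (tau (Suc n)) (x (Suc n)) (x n)"
    "is_proj C (x (Suc n) - lam (Suc n) *\<^sub>R F (y (Suc n))) (x (Suc (Suc n)))" for n
    using alg[unfolded algorithm1_def, THEN conjunct2, rule_format, of "Suc n"]
    by (auto simp: Let_def is_largest_def)
  have lam: "0 < lam n" for n
    using init step(2)[of "n - 1"] by (cases n) (auto simp: steps1_def)
  have tau: "0 < tau n" for n
    using init step(1)[of "n - 1"] by (cases n) auto
  show ?thesis
  proof
    show "lam (Suc n) * tau (Suc n) \<le> (1 + tau n) * lam n" for n
      using step(2)[of n] tau[of "Suc n"] by (simp add: steps1_def pos_le_divide_eq)
    show "norm (lam (Suc n) *\<^sub>R F (y (Suc n)) - (tau (Suc n) * lam n) *\<^sub>R F (y n)) \<le> \<alpha> * norm (y (Suc n) - y n)" for n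
      using step(2,3)[of n] by (simp add: steps1_def mult.commute)
    show "is_prox (\<lambda>z. ereal (lam n) * indicator_fun C z) (x n - lam n *\<^sub>R F (y n)) (x (Suc n))" for n
    proof (cases n)
      case (Suc m)
      \<comment> \<open>Positive scaling fixes an indicator function, so the projection is its
        proximal map for every step size.\<close>
      have "(\<lambda>z. ereal (lam n) * indicator_fun C z) = indicator_fun C"
        using lam[of n] by (auto simp: indicator_fun_def)
      with step(4)[of m] Suc show ?thesis by (simp add: is_proj_def)
    qed (use start in simp)
    \<comment> \<open>Both sides are 0, also off \<open>C\<close>, since
      \<open>real_of_ereal\<close> sends infinity to 0.\<close>
    show "lam (Suc n) * (real_of_ereal (indicator_fun C u) - real_of_ereal (indicator_fun C v))
        = tau (Suc n) * lam n * (real_of_ereal (indicator_fun C u) - real_of_ereal (indicator_fun C v))" for n u v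
      by (simp add: indicator_fun_def)
  qed (use assms init step lam tau in auto)
qed

lemma algorithm2_extrapolated_prox_gradient:
  fixes F :: "'a::real_inner \<Rightarrow> 'a"
  assumes "monotone_op F" "proper_fun g" "convex_fun g"
    and alg: "algorithm2 F g \<alpha> lmax \<sigma> x y lam tau"
    and start: "is_prox (\<lambda>z. ereal (lam 0) * g z) (x 0 - lam 0 *\<^sub>R F (y 0)) (x 1)"
  shows "extrapolated_prox_gradient F g x y lam tau \<alpha>"
proof -
  have init: "0 < \<alpha>" "\<alpha> < sqrt 2 - 1" "0 < \<sigma>" "\<sigma> < 1" "0 < lam 0" "tau 0 = 1"
    using alg by (auto simp: algorithm2_def admissible_init_def)
  have step: "\<exists>i. tau (Suc n) = trial2 lmax \<sigma> (lam n) (tau n) i"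
    "accepted2 F \<alpha> (x (Suc n)) (x n) (y n) (lam n) (tau (Suc n))"
    "lam (Suc n) = tau (Suc n) * lam n"
    "y (Suc n) = extrapolate (tau (Suc n)) (x (Suc n)) (x n)"
    "is_prox (\<lambda>z. ereal (lam (Suc n)) * g z) (x (Suc n) - lam (Suc n) *\<^sub>R F (y (Suc n))) (x (Suc (Suc n)))" for n
    using alg[unfolded algorithm2_def, THEN conjunct2, rule_format, of "Suc n"]
    by (auto simp: Let_def)
  have tau: "0 < tau n" for n
  proof (induction n)
    case (Suc n)
    with step(1)[of n] init show ?case by (auto simp: trial2_def)
  qed (simp add: init)
  have lam: "0 < lam n" for n
    by (induction n) (simp_all add: init step(3) tau)
  have tau_sq: "tau (Suc n) * tau (Suc n) \<le> 1 + tau n" for n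
  proof -
    obtain i where i: "tau (Suc n) = trial2 lmax \<sigma> (lam n) (tau n) i" using step(1) by blast
    \<comment> \<open>Both branches of \<open>trial2\<close> stay below
      \<open>sqrt (1 + tau n)\<close>, the second because
      \<open>\<sigma> ^ i \<le> 1\<close>.\<close>
    have "\<sigma> ^ i \<le> 1" "0 \<le> \<sigma> ^ i" using init by (simp_all add: power_le_one)
    then have "tau (Suc n) \<le> sqrt (1 + tau n)"
      using tau[of n] by (auto simp: i trial2_def mult_left_le intro: order_trans)
    then have "tau (Suc n) * tau (Suc n) \<le> sqrt (1 + tau n) * sqrt (1 + tau n)"
      using tau[of n] tau[of "Suc n"] by (intro mult_mono) auto
    then show ?thesis using tau[of n] by simp
  qed
  show ?thesis
  proof
    show "lam (Suc n) * tau (Suc n) \<le> (1 + tau n) * lam n" for n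
      using mult_right_mono[OF tau_sq less_imp_le[OF lam], of n n] by (simp add: step(3) mult_ac)
    show "norm (lam (Suc n) *\<^sub>R F (y (Suc n)) - (tau (Suc n) * lam n) *\<^sub>R F (y n)) \<le> \<alpha> * norm (y (Suc n) - y n)" for n
      using step(2)[of n] lam[of n] tau[of "Suc n"]
      by (simp add: accepted2_def step(3) step(4)[symmetric] flip: scaleR_diff_right)
    show "is_prox (\<lambda>z. ereal (lam n) * g z) (x n - lam n *\<^sub>R F (y n)) (x (Suc n))" for n
      using start step(5) by (cases n) auto
    show "lam (Suc n) * (real_of_ereal (g u) - real_of_ereal (g v))
        = tau (Suc n) * lam n * (real_of_ereal (g u) - real_of_ereal (g v))" for n u v
      by (simp add: step(3))
  qed (use assms init step(4) lam tau in auto)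
qed

text \<open>The hypothesis \<open>start\<close> makes \<open>x 1\<close> a proximal point too, which
  supplies the older optimality condition for the first linesearch step and puts \<open>x 1\<close>
  into the domain.\<close>

theorem theorem2:
  fixes F :: "'a::euclidean_space \<Rightarrow> 'a" and g :: "'a \<Rightarrow> ereal"
    and x y :: "nat \<Rightarrow> 'a" and lam tau :: "nat \<Rightarrow> real"
    and \<alpha> lmax \<sigma> :: real and N :: nat
  assumes "locally_Lipschitz F" and "monotone_op F"
    and "proper_fun g" and "lsc_fun g" and "convex_fun g" and "continuous_on (edom g) g"
    and "\<exists>xs. is_solution F g xs"
    and "(\<exists>C. closed C \<and> convex C \<and> g = indicator_fun C \<and> algorithm1 F C \<alpha> lmax \<sigma> x y lam tau)
         \<or> algorithm2 F g \<alpha> lmax \<sigma> x y lam tau"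
    and start: "is_prox (\<lambda>z. ereal (lam 0) * g z) (x 0 - lam 0 *\<^sub>R F (y 0)) (x 1)"
    and "N \<ge> 1"
  defines "R \<equiv> \<lambda>z. ereal ((norm (x 1 - z))\<^sup>2 + \<alpha> * (norm (x 1 - y 0))\<^sup>2)
                   + ereal (2 * lam 1 * tau 1) * Psi F g z (x 0)"
  shows "x_bar x y lam tau N \<in> edom g \<and>
    (\<forall>z\<in>edom g.
       (0 \<le> R z \<longrightarrow> Psi F g z (x_bar x y lam tau N) \<le> R z / ereal (lam_bar lam tau N)) \<and>
       Psi F g z (x_bar x y lam tau N) \<le> R z / ereal (2 * lam_bar lam tau N))"
proof -
  interpret extrapolated_prox_gradient F g x y lam tau \<alpha>
    using assms(8) algorithm1_extrapolated_prox_gradient algorithm2_extrapolated_prox_gradient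
      assms(2,3,5) start by blast
  have bound: "Psi F g z (x_bar x y lam tau N) \<le> R z / ereal (2 * lam_bar lam tau N)" if "z \<in> edom g" for z
    unfolding R_def by (rule Psi_x_bar_le[OF \<open>N \<ge> 1\<close> that])
  \<comment> \<open>Halving the denominator enlarges the quotient only for a nonnegative numerator,
    hence the sign condition.\<close>
  moreover have "R z / ereal (2 * lam_bar lam tau N) \<le> R z / ereal (lam_bar lam tau N)" if "0 \<le> R z" for z
    using that lam_bar_pos[of N] by (cases "R z") (auto simp: field_simps)
  ultimately show ?thesis
    using x_bar_in_edom[OF \<open>N \<ge> 1\<close>] order_trans by blast
qed

end
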